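(* Let $X$ be a bounded distributive lattice, let $n\geqslant 1$ be an integer, and let $f\colon X^n\to X$ be an order-preserving and $\mathcal{R}_f$-idempotent function whose diagonal section $\delta_f$ is a lattice homomorphism with a convex range. The following are equivalent: (i) $f$ is a polynomial function. (ii) $f$ is quasi-$\wedge$-homogeneous and quasi-$\vee$-homogeneous. (iii) $f$ is quasi-$\wedge$-homogeneous and horizontally $\vee$-decomposable. (iv) $f$ is horizontally $\wedge$-decomposable and quasi-$\vee$-homogeneous.
   Context: $X$ has operations $\wedge,\vee$ and least and greatest elements $0$ and $1$; $X^n$ is ordered componentwise; $[n]=\{1,\ldots,n\}$. A lattice homomorphism is a map preserving $\wedge$ and $\vee$ (it is not required to preserve $0$ and $1$). A subset $S\subseteq X$ is convex if $a,b\in S$, $c\in X$ and $a\leqslant c\leqslant b$ imply $c\in S$. A (lattice) polynomial function $p\colon X^n\to X$ is any map which can be obtained as a composition of the lattice operations $\wedge$ and $\vee$, the projections $\mathbf{x}\mapsto x_i$ ($i\in[n]$), and the constant functions $\mathbf{x}\mapsto c$ ($c\in X$). The diagonal section of $f$ is $\delta_f\colon X\to X$, $\delta_f(x)=f(x,\ldots,x)$, and $\mathcal{R}_f$ is the range of $f$. $f$ is $\mathcal{R}_f$-idempotent if $\delta_f(c)=c$ for every $c\in\mathcal{R}_f$. For $\mathbf{x}\in X^n$ and $c\in X$: $\mathbf{x}\wedge c=(x_1\wedge c,\ldots,x_n\wedge c)$, $\mathbf{x}\vee c=(x_1\vee c,\ldots,x_n\vee c)$; $[\mathbf{x}]_c$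 is the $n$-tuple whose $i$th component is $0$ if $x_i\leqslant c$, and $x_i$ otherwise; $[\mathbf{x}]^c$ is the $n$-tuple whose $i$th component is $1$ if $x_i\geqslant c$, and $x_i$ otherwise. $f$ is quasi-$\vee$-homogeneous (resp. quasi-$\wedge$-homogeneous) if $f(\mathbf{x}\vee c)=f(\mathbf{x})\vee\delta_f(c)$ (resp. $f(\mathbf{x}\wedge c)=f(\mathbf{x})\wedge\delta_f(c)$) for every $\mathbf{x}\in X^n$ and $c\in X$. $f$ is horizontally $\wedge$-decomposable (resp. horizontally $\vee$-decomposable) if $f(\mathbf{x})=f(\mathbf{x}\vee c)\wedge f([\mathbf{x}]^c)$ (resp. $f(\mathbf{x})=f(\mathbf{x}\wedge c)\vee f([\mathbf{x}]_c)$) for every $\mathbf{x}\in X^n$ and $c\in X$. *)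

theory Defs
  imports Main
begin

text \<open>
  The lattice \<open>X\<close> is a type \<open>'a\<close>, and \<open>X\<^sup>n\<close> is the function type \<open>'n \<Rightarrow> 'a\<close> over a finite index
  type, ordered pointwise. Types are nonempty, so \<open>n = CARD('n)\<close> ranges over all integers
  \<open>n \<ge> 1\<close>. The case \<open>\<bottom> = \<top>\<close> is not excluded.
\<close>

definition order_convex :: "'a::order set \<Rightarrow> bool" where
  "order_convex S \<longleftrightarrow> (\<forall>a\<in>S. \<forall>b\<in>S. \<forall>c. a \<le> c \<and> c \<le> b \<longrightarrow> c \<in> S)"

text \<open>Lattice homomorphisms need not preserve \<open>\<bottom>\<close> and \<open>\<top>\<close>.\<close>

definition lattice_hom :: "('a::lattice \<Rightarrow> 'b::lattice) \<Rightarrow> bool" where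
  "lattice_hom g \<longleftrightarrow>
     (\<forall>x y. g (inf x y) = inf (g x) (g y)) \<and> (\<forall>x y. g (sup x y) = sup (g x) (g y))"

inductive polynomial_function :: "(('n::finite \<Rightarrow> 'a::lattice) \<Rightarrow> 'a) \<Rightarrow> bool" where
  proj: "polynomial_function (\<lambda>x. x i)"
| const: "polynomial_function (\<lambda>x. c)"
| inf: "polynomial_function p \<Longrightarrow> polynomial_function q \<Longrightarrow>
    polynomial_function (\<lambda>x. inf (p x) (q x))"
| sup: "polynomial_function p \<Longrightarrow> polynomial_function q \<Longrightarrow>
    polynomial_function (\<lambda>x. sup (p x) (q x))"

definition diag_section :: "(('n::finite \<Rightarrow> 'a) \<Rightarrow> 'a) \<Rightarrow> 'a \<Rightarrow> 'a" where
  "diag_section f x = f (\<lambda>i. x)"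

definition range_idempotent :: "(('n::finite \<Rightarrow> 'a) \<Rightarrow> 'a) \<Rightarrow> bool" where
  "range_idempotent f \<longleftrightarrow> (\<forall>c\<in>range f. diag_section f c = c)"

text \<open>\<open>lower_trunc c x\<close> is the tuple $[\mathbf{x}]_c$ and \<open>upper_trunc c x\<close> is $[\mathbf{x}]^c$.\<close>

definition lower_trunc :: "'a::{order, bot} \<Rightarrow> ('n::finite \<Rightarrow> 'a) \<Rightarrow> 'n \<Rightarrow> 'a" where
  "lower_trunc c x = (\<lambda>i. if x i \<le> c then bot else x i)"

definition upper_trunc :: "'a::{order, top} \<Rightarrow> ('n::finite \<Rightarrow> 'a) \<Rightarrow> 'n \<Rightarrow> 'a" where
  "upper_trunc c x = (\<lambda>i. if x i \<ge> c then top else x i)"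

definition quasi_sup_homogeneous :: "(('n::finite \<Rightarrow> 'a::lattice) \<Rightarrow> 'a) \<Rightarrow> bool" where
  "quasi_sup_homogeneous f \<longleftrightarrow>
     (\<forall>x c. f (\<lambda>i. sup (x i) c) = sup (f x) (diag_section f c))"

definition quasi_inf_homogeneous :: "(('n::finite \<Rightarrow> 'a::lattice) \<Rightarrow> 'a) \<Rightarrow> bool" where
  "quasi_inf_homogeneous f \<longleftrightarrow>
     (\<forall>x c. f (\<lambda>i. inf (x i) c) = inf (f x) (diag_section f c))"

definition horizontally_inf_decomposable ::
    "(('n::finite \<Rightarrow> 'a::bounded_lattice) \<Rightarrow> 'a) \<Rightarrow> bool" where
  "horizontally_inf_decomposable f \<longleftrightarrow>
     (\<forall>x c. f x = inf (f (\<lambda>i. sup (x i) c)) (f (upper_trunc c x)))"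

definition horizontally_sup_decomposable ::
    "(('n::finite \<Rightarrow> 'a::bounded_lattice) \<Rightarrow> 'a) \<Rightarrow> bool" where
  "horizontally_sup_decomposable f \<longleftrightarrow>
     (\<forall>x c. f x = sup (f (\<lambda>i. inf (x i) c)) (f (lower_trunc c x)))"

end

theory Submission
  imports Defs
begin

text \<open>
  The theorem rests on Goodstein's median decomposition: fixing all coordinates but \<open>k\<close>, a
  function is recovered from its values at \<open>\<bottom>\<close> and \<open>\<top>\<close>,
  \<open>f x = f (x(k := \<bottom>)) \<squnion> (f (x(k := \<top>)) \<sqinter> \<delta>\<^sub>f (x k))\<close>.
  Suppose that \<open>\<delta>\<^sub>f\<close> is itself a polynomial. Applying the decomposition to one coordinate after
  another replaces \<open>f\<close> by its values on tuples over \<open>{\<bottom>, \<top>}\<close>, which are constants, and so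
  exhibits \<open>f\<close> as a polynomial (\<open>polynomial_function_if_median_decomposition\<close>).

  For a monotone \<open>f\<close>, the decomposition at \<open>k\<close> follows from two inequalities,
  \<open>f x \<le> f (x(k := \<bottom>)) \<squnion> \<delta>\<^sub>f (x k)\<close> and its dual \<open>f (x(k := \<top>)) \<sqinter> \<delta>\<^sub>f (x k) \<le> f x\<close>. Either of
  the two \<open>\<squnion>\<close>-conditions (quasi-homogeneity, horizontal decomposability) yields the first one,
  and either of the two \<open>\<sqinter>\<close>-conditions the second one: in each case one takes \<open>c = x k\<close>. Hence
  each of (ii), (iii), (iv) provides both inequalities.

  That \<open>\<delta>\<^sub>f\<close> is a polynomial is where the remaining hypotheses enter. A lattice endomorphism that
  fixes its range, when this range is an interval \<open>[a, b]\<close>, takes the same value on \<open>x\<close> and on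
  \<open>(x \<squnion> a) \<sqinter> b\<close>; the latter lies in the range and is fixed
  (\<open>retraction_onto_convex_range\<close>).

  Conversely, a polynomial \<open>p\<close> satisfies \<open>p x \<sqinter> c \<le> p (x \<sqinter> c) \<le> p \<bottom> \<squnion> c\<close> and the dual
  inequalities. These bounds, obtained by induction on \<open>p\<close>, give all four conditions.
\<close>

section \<open>Polynomial functions are homogeneous and decomposable\<close>

lemma mono_polynomial_function: "polynomial_function p \<Longrightarrow> mono p"
proof (induction rule: polynomial_function.induct)
  case (inf p q)
  then show ?case by (auto simp: mono_def intro: le_infI1 le_infI2)
next
  case (sup p q)
  then show ?case by (auto simp: mono_def intro: le_supI1 le_supI2)
qed (auto intro: monoI le_funD)

context
  fixes p :: "('n::finite \<Rightarrow> 'a::{distrib_lattice, bounded_lattice}) \<Rightarrow> 'a"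
  assumes p: "polynomial_function p"
begin

lemma polynomial_inf_le: "inf (p x) c \<le> p (\<lambda>i. inf (x i) c)"
  using p
proof (induction rule: polynomial_function.induct)
  case (inf p q)
  have "inf (inf (p x) (q x)) c = inf (inf (p x) c) (inf (q x) c)"
    by (simp add: inf_assoc inf_commute inf_left_commute)
  also have "\<dots> \<le> inf (p (\<lambda>i. inf (x i) c)) (q (\<lambda>i. inf (x i) c))"
    using inf.IH by (rule inf_mono)
  finally show ?case .
next
  case (sup p q)
  have "inf (sup (p x) (q x)) c = sup (inf (p x) c) (inf (q x) c)"
    by (simp add: inf_sup_distrib2)
  also have "\<dots> \<le> sup (p (\<lambda>i. inf (x i) c)) (q (\<lambda>i. inf (x i) c))"
    using sup.IH by (rule sup_mono)
  finally show ?case .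
qed auto

lemma polynomial_le_sup: "p (\<lambda>i. sup (x i) c) \<le> sup (p x) c"
  using p
proof (induction rule: polynomial_function.induct)
  case (inf p q)
  have "inf (p (\<lambda>i. sup (x i) c)) (q (\<lambda>i. sup (x i) c)) \<le> inf (sup (p x) c) (sup (q x) c)"
    using inf.IH by (rule inf_mono)
  also have "\<dots> = sup (inf (p x) (q x)) c"
    by (simp add: sup_inf_distrib2)
  finally show ?case .
next
  case (sup p q)
  have "sup (p (\<lambda>i. sup (x i) c)) (q (\<lambda>i. sup (x i) c)) \<le> sup (sup (p x) c) (sup (q x) c)"
    using sup.IH by (rule sup_mono)
  also have "\<dots> = sup (sup (p x) (q x)) c"
    by (simp add: sup_assoc sup_commute sup_left_commute)
  finally show ?case .
qed auto

lemma polynomial_inf_le_sup_bot: "p (\<lambda>i. inf (x i) c) \<le> sup (p (\<lambda>i. bot)) c"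
proof -
  have "p (\<lambda>i. inf (x i) c) \<le> p (\<lambda>i. sup bot c)"
    by (rule monoD[OF mono_polynomial_function[OF p]]) (simp add: le_fun_def)
  also have "\<dots> \<le> sup (p (\<lambda>i. bot)) c"
    by (rule polynomial_le_sup)
  finally show ?thesis .
qed

lemma polynomial_inf_top_le_sup: "inf (p (\<lambda>i. top)) c \<le> p (\<lambda>i. sup (x i) c)"
proof -
  have "inf (p (\<lambda>i. top)) c \<le> p (\<lambda>i. inf top c)"
    by (rule polynomial_inf_le)
  also have "\<dots> \<le> p (\<lambda>i. sup (x i) c)"
    by (rule monoD[OF mono_polynomial_function[OF p]]) (simp add: le_fun_def)
  finally show ?thesis .
qed

lemma polynomial_quasi_inf_homogeneous: "quasi_inf_homogeneous p"
  unfolding quasi_inf_homogeneous_def diag_section_def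
proof (intro allI order.antisym)
  fix x c
  have mono: "mono p" by (rule mono_polynomial_function[OF p])
  show "p (\<lambda>i. inf (x i) c) \<le> inf (p x) (p (\<lambda>i. c))"
    by (intro le_infI monoD[OF mono]) (simp_all add: le_fun_def)
  have "p (\<lambda>i. c) \<le> sup (p (\<lambda>i. bot)) c"
    using polynomial_inf_le_sup_bot[of "\<lambda>i. c" c] by simp
  then have "inf (p x) (p (\<lambda>i. c)) \<le> inf (p x) (sup (p (\<lambda>i. bot)) c)"
    by (rule inf_mono[OF order.refl])
  also have "\<dots> = sup (inf (p x) (p (\<lambda>i. bot))) (inf (p x) c)"
    by (rule inf_sup_distrib1)
  also have "\<dots> \<le> p (\<lambda>i. inf (x i) c)"
    by (intro le_supI le_infI2 polynomial_inf_le monoD[OF mono]) (simp add: le_fun_def)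
  finally show "inf (p x) (p (\<lambda>i. c)) \<le> p (\<lambda>i. inf (x i) c)" .
qed

lemma polynomial_quasi_sup_homogeneous: "quasi_sup_homogeneous p"
  unfolding quasi_sup_homogeneous_def diag_section_def
proof (intro allI order.antisym)
  fix x c
  have mono: "mono p" by (rule mono_polynomial_function[OF p])
  show "sup (p x) (p (\<lambda>i. c)) \<le> p (\<lambda>i. sup (x i) c)"
    by (intro le_supI monoD[OF mono]) (simp_all add: le_fun_def)
  have "p (\<lambda>i. sup (x i) c) \<le> inf (sup (p x) (p (\<lambda>i. top))) (sup (p x) c)"
    by (intro le_infI le_supI2 polynomial_le_sup monoD[OF mono]) (simp add: le_fun_def)
  also have "\<dots> = sup (p x) (inf (p (\<lambda>i. top)) c)"
    by (rule sup_inf_distrib1[symmetric])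
  also have "inf (p (\<lambda>i. top)) c \<le> p (\<lambda>i. c)"
    using polynomial_inf_top_le_sup[of c "\<lambda>i. c"] by simp
  then have "sup (p x) (inf (p (\<lambda>i. top)) c) \<le> sup (p x) (p (\<lambda>i. c))"
    by (rule sup_mono[OF order.refl])
  finally show "p (\<lambda>i. sup (x i) c) \<le> sup (p x) (p (\<lambda>i. c))" .
qed

end

lemma lower_trunc_le: "lower_trunc c x \<le> (x :: 'n::finite \<Rightarrow> 'a::bounded_lattice)"
  by (simp add: lower_trunc_def le_fun_def)

lemma le_upper_trunc: "(x :: 'n::finite \<Rightarrow> 'a::bounded_lattice) \<le> upper_trunc c x"
  by (simp add: upper_trunc_def le_fun_def)

text \<open>
  In the induction for horizontal \<open>\<squnion>\<close>-decomposability, distributing a meet \<open>p \<sqinter> q\<close> produces the mixed term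
  \<open>p (x \<sqinter> c) \<sqinter> q [x]\<^sub>c\<close>. It is absorbed because \<open>p (x \<sqinter> c) \<le> p \<bottom> \<squnion> c\<close>: the part below
  \<open>p \<bottom>\<close> lies below \<open>p [x]\<^sub>c \<sqinter> q [x]\<^sub>c\<close>, and the part below \<open>c\<close> lies below
  \<open>p x \<sqinter> q x \<sqinter> c \<le> p (x \<sqinter> c) \<sqinter> q (x \<sqinter> c)\<close>. The lemma after it is the dual.
\<close>

lemma polynomial_mixed_inf_le:
  fixes p q :: "('n::finite \<Rightarrow> 'a::{distrib_lattice, bounded_lattice}) \<Rightarrow> 'a"
  assumes p: "polynomial_function p" and q: "polynomial_function q"
  shows "inf (p (\<lambda>i. inf (x i) c)) (q (lower_trunc c x)) \<le>
    sup (inf (p (\<lambda>i. inf (x i) c)) (q (\<lambda>i. inf (x i) c)))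
        (inf (p (lower_trunc c x)) (q (lower_trunc c x)))"
    (is "inf ?px ?qt \<le> sup ?A ?B")
proof -
  note mp = monoD[OF mono_polynomial_function[OF p]]
    and mq = monoD[OF mono_polynomial_function[OF q]]
  have "p (\<lambda>i. bot) \<le> p (lower_trunc c x)"
    by (rule mp) (simp add: le_fun_def)
  then have B: "inf (p (\<lambda>i. bot)) ?qt \<le> ?B"
    by (rule inf_mono) simp
  have "?qt \<le> q x" by (rule mq) (rule lower_trunc_le)
  then have "inf c ?qt \<le> inf (q x) c"
    by (simp add: le_infI2)
  also have "\<dots> \<le> q (\<lambda>i. inf (x i) c)" by (rule polynomial_inf_le[OF q])
  finally have A: "inf ?px (inf c ?qt) \<le> ?A"
    by (intro inf_mono) auto
  have "inf ?px ?qt = inf (inf ?px (sup (p (\<lambda>i. bot)) c)) ?qt"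
    using polynomial_inf_le_sup_bot[OF p, of x c] by (simp add: inf_absorb1)
  also have "\<dots> = sup (inf ?px (inf (p (\<lambda>i. bot)) ?qt)) (inf ?px (inf c ?qt))"
    by (simp add: inf_sup_distrib1 inf_sup_distrib2 inf_assoc)
  also have "\<dots> \<le> sup ?A ?B"
    using A B by (simp add: le_infI2 le_supI1 le_supI2)
  finally show ?thesis .
qed

lemma polynomial_mixed_sup_ge:
  fixes p q :: "('n::finite \<Rightarrow> 'a::{distrib_lattice, bounded_lattice}) \<Rightarrow> 'a"
  assumes p: "polynomial_function p" and q: "polynomial_function q"
  shows "inf (sup (p (\<lambda>i. sup (x i) c)) (q (\<lambda>i. sup (x i) c)))
        (sup (p (upper_trunc c x)) (q (upper_trunc c x)))
    \<le> sup (p (\<lambda>i. sup (x i) c)) (q (upper_trunc c x))"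
    (is "inf ?A ?B \<le> sup ?px ?qt")
proof -
  note mp = monoD[OF mono_polynomial_function[OF p]]
    and mq = monoD[OF mono_polynomial_function[OF q]]
  have "p (upper_trunc c x) \<le> p (\<lambda>i. top)"
    by (rule mp) (simp add: le_fun_def)
  then have B: "?B \<le> sup (p (\<lambda>i. top)) ?qt"
    by (rule sup_mono) simp
  have "q (\<lambda>i. sup (x i) c) \<le> sup (q x) c" by (rule polynomial_le_sup[OF q])
  also have "q x \<le> ?qt" by (rule mq) (rule le_upper_trunc)
  then have "sup (q x) c \<le> sup c ?qt"
    by (simp add: le_supI2)
  finally have A: "?A \<le> sup ?px (sup c ?qt)"
    by (intro sup_mono) auto
  have "inf ?A ?B \<le> inf (sup ?px (sup (p (\<lambda>i. top)) ?qt)) (sup ?px (sup c ?qt))"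
    using A B by (simp add: le_infI1 le_infI2 le_supI2)
  also have "\<dots> = sup (sup ?px (inf (p (\<lambda>i. top)) c)) ?qt"
    by (simp add: sup_inf_distrib1 sup_inf_distrib2 sup_assoc)
  also have "\<dots> = sup ?px ?qt"
    using polynomial_inf_top_le_sup[OF p, of c x] by (simp add: sup_absorb1)
  finally show ?thesis .
qed

lemma polynomial_horizontally_sup_decomposable:
  fixes p :: "('n::finite \<Rightarrow> 'a::{distrib_lattice, bounded_lattice}) \<Rightarrow> 'a"
  assumes p: "polynomial_function p"
  shows "horizontally_sup_decomposable p"
  unfolding horizontally_sup_decomposable_def
proof (intro allI order.antisym)
  fix x c
  show "sup (p (\<lambda>i. inf (x i) c)) (p (lower_trunc c x)) \<le> p x"
    by (intro le_supI monoD[OF mono_polynomial_function[OF p]] lower_trunc_le)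
      (simp add: le_fun_def)
  show "p x \<le> sup (p (\<lambda>i. inf (x i) c)) (p (lower_trunc c x))"
    using p
  proof (induction rule: polynomial_function.induct)
    case (proj i)
    then show ?case by (auto simp: lower_trunc_def inf_absorb1)
  next
    case (const d)
    then show ?case by simp
  next
    case (inf p q)
    let ?pa = "p (\<lambda>i. inf (x i) c)" and ?pb = "p (lower_trunc c x)"
    let ?qa = "q (\<lambda>i. inf (x i) c)" and ?qb = "q (lower_trunc c x)"
    let ?R = "sup (inf ?pa ?qa) (inf ?pb ?qb)"
    have "inf (p x) (q x) \<le> inf (sup ?pa ?pb) (sup ?qa ?qb)"
      using inf.IH by (rule inf_mono)
    also have "\<dots> = sup ?R (sup (inf ?pa ?qb) (inf ?pb ?qa))"
      by (simp add: inf_sup_distrib1 inf_sup_distrib2 sup_assoc sup_commute sup_left_commute)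
    also have "\<dots> \<le> ?R"
      using polynomial_mixed_inf_le[OF inf.hyps, of x c]
        polynomial_mixed_inf_le[OF inf.hyps(2,1), of x c]
      by (simp add: inf_commute)
    finally show ?case .
  next
    case (sup p q)
    from sup_mono[OF sup.IH] show ?case by (simp add: sup_assoc sup_commute sup_left_commute)
  qed
qed

lemma polynomial_horizontally_inf_decomposable:
  fixes p :: "('n::finite \<Rightarrow> 'a::{distrib_lattice, bounded_lattice}) \<Rightarrow> 'a"
  assumes p: "polynomial_function p"
  shows "horizontally_inf_decomposable p"
  unfolding horizontally_inf_decomposable_def
proof (intro allI order.antisym)
  fix x c
  show "p x \<le> inf (p (\<lambda>i. sup (x i) c)) (p (upper_trunc c x))"
    by (intro le_infI monoD[OF mono_polynomial_function[OF p]] le_upper_trunc)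
      (simp add: le_fun_def)
  show "inf (p (\<lambda>i. sup (x i) c)) (p (upper_trunc c x)) \<le> p x"
    using p
  proof (induction rule: polynomial_function.induct)
    case (proj i)
    then show ?case by (auto simp: upper_trunc_def sup_absorb1)
  next
    case (const d)
    then show ?case by simp
  next
    case (inf p q)
    from inf_mono[OF inf.IH] show ?case by (simp add: inf_assoc inf_commute inf_left_commute)
  next
    case (sup p q)
    let ?pa = "p (\<lambda>i. sup (x i) c)" and ?pb = "p (upper_trunc c x)"
    let ?qa = "q (\<lambda>i. sup (x i) c)" and ?qb = "q (upper_trunc c x)"
    let ?L = "inf (sup ?pa ?qa) (sup ?pb ?qb)"
    have "?L \<le> inf ?L (inf (sup ?pa ?qb) (sup ?pb ?qa))"
      using polynomial_mixed_sup_ge[OF sup.hyps, of x c]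
        polynomial_mixed_sup_ge[OF sup.hyps(2,1), of x c]
      by (simp add: sup_commute)
    also have "\<dots> = sup (inf ?pa ?pb) (inf ?qa ?qb)"
      by (simp add: sup_inf_distrib1 sup_inf_distrib2 inf_assoc inf_commute inf_left_commute)
    also have "\<dots> \<le> sup (p x) (q x)"
      using sup.IH by (rule sup_mono)
    finally show ?case .
  qed
qed

section \<open>The diagonal section\<close>

text \<open>
  Convexity puts \<open>(x \<squnion> g \<bottom>) \<sqinter> g \<top>\<close> into the range, so \<open>g\<close> fixes it; and \<open>g\<close>, being a
  homomorphism with \<open>g \<bottom> \<le> g x \<le> g \<top>\<close>, sends it to \<open>g x\<close>.
\<close>

lemma retraction_onto_convex_range:
  fixes g :: "'a::{distrib_lattice, bounded_lattice} \<Rightarrow> 'a"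
  assumes hom: "lattice_hom g"
    and convex: "order_convex (range g)"
    and fixes_range: "\<And>c. c \<in> range g \<Longrightarrow> g c = c"
  shows "g x = inf (sup x (g bot)) (g top)"
proof -
  have g_inf: "g (inf y z) = inf (g y) (g z)" and g_sup: "g (sup y z) = sup (g y) (g z)" for y z
    using hom by (simp_all add: lattice_hom_def)
  have bot_le: "g bot \<le> g y" for y
    using g_sup[of bot y] by (simp add: le_iff_sup)
  have le_top: "g y \<le> g top" for y
    using g_inf[of y top] by (simp add: le_iff_inf)
  let ?y = "inf (sup x (g bot)) (g top)"
  have "g bot \<le> ?y" "?y \<le> g top"
    using bot_le[of top] by simp_all
  then have "?y \<in> range g"
    using convex unfolding order_convex_def by blast
  then have "?y = g ?y"
    by (rule fixes_range[symmetric])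
  also have "g ?y = inf (sup (g x) (g bot)) (g top)"
    by (simp only: g_inf g_sup fixes_range[OF rangeI])
  also have "\<dots> = g x"
    using bot_le[of x] le_top[of x] by (simp add: sup_absorb1 inf_absorb1)
  finally show ?thesis by simp
qed

section \<open>Median decomposition\<close>

text \<open>
  In each of the next four lemmas the condition is used with \<open>c = x k\<close>. This choice makes
  \<open>x \<squnion> c\<close> insensitive to lowering the \<open>k\<close>th coordinate to \<open>\<bottom>\<close>, makes \<open>x \<sqinter> c\<close> insensitive to
  raising it to \<open>\<top>\<close>, and makes truncation at \<open>c\<close> replace it by \<open>\<bottom>\<close> or \<open>\<top>\<close>.
\<close>

lemma quasi_sup_homogeneous_le:
  fixes f :: "('n::finite \<Rightarrow> 'a::bounded_lattice) \<Rightarrow> 'a"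
  assumes "quasi_sup_homogeneous f"
  shows "f x \<le> sup (f (x(k := bot))) (diag_section f (x k))"
proof -
  have "(\<lambda>i. sup ((x(k := bot)) i) (x k)) = (\<lambda>i. sup (x i) (x k))"
    by auto
  then have "sup (f x) (diag_section f (x k)) = sup (f (x(k := bot))) (diag_section f (x k))"
    using assms unfolding quasi_sup_homogeneous_def by metis
  then show ?thesis by (metis sup.cobounded1)
qed

lemma quasi_inf_homogeneous_le:
  fixes f :: "('n::finite \<Rightarrow> 'a::bounded_lattice) \<Rightarrow> 'a"
  assumes "quasi_inf_homogeneous f"
  shows "inf (f (x(k := top))) (diag_section f (x k)) \<le> f x"
proof -
  have "(\<lambda>i. inf ((x(k := top)) i) (x k)) = (\<lambda>i. inf (x i) (x k))"
    by auto
  then have "inf (f x) (diag_section f (x k)) = inf (f (x(k := top))) (diag_section f (x k))"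
    using assms unfolding quasi_inf_homogeneous_def by metis
  then show ?thesis by (metis inf.cobounded1)
qed

lemma horizontally_sup_decomposable_le:
  fixes f :: "('n::finite \<Rightarrow> 'a::bounded_lattice) \<Rightarrow> 'a"
  assumes mono: "mono f" and decomp: "horizontally_sup_decomposable f"
  shows "f x \<le> sup (f (x(k := bot))) (diag_section f (x k))"
proof -
  have "f x = sup (f (\<lambda>i. inf (x i) (x k))) (f (lower_trunc (x k) x))"
    using decomp unfolding horizontally_sup_decomposable_def by blast
  also have "\<dots> \<le> sup (diag_section f (x k)) (f (x(k := bot)))"
    unfolding diag_section_def
    by (intro sup_mono monoD[OF mono]) (simp_all add: le_fun_def lower_trunc_def)
  finally show ?thesis by (simp add: sup_commute)
qed

lemma horizontally_inf_decomposable_le: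
  fixes f :: "('n::finite \<Rightarrow> 'a::bounded_lattice) \<Rightarrow> 'a"
  assumes mono: "mono f" and decomp: "horizontally_inf_decomposable f"
  shows "inf (f (x(k := top))) (diag_section f (x k)) \<le> f x"
proof -
  have "inf (diag_section f (x k)) (f (x(k := top))) \<le>
      inf (f (\<lambda>i. sup (x i) (x k))) (f (upper_trunc (x k) x))"
    unfolding diag_section_def
    by (intro inf_mono monoD[OF mono]) (simp_all add: le_fun_def upper_trunc_def)
  also have "\<dots> = f x"
    using decomp unfolding horizontally_inf_decomposable_def by metis
  finally show ?thesis by (simp add: inf_commute)
qed

text \<open>
  The upper bound on \<open>f x\<close> combines \<open>le\<close> with \<open>f x \<le> f (x(k := \<top>))\<close>, and distributivity turns
  the meet of the two right-hand sides into the decomposition.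
\<close>

lemma median_decomposition:
  fixes f :: "('n::finite \<Rightarrow> 'a::{distrib_lattice, bounded_lattice}) \<Rightarrow> 'a"
  assumes mono: "mono f"
    and le: "f x \<le> sup (f (x(k := bot))) d"
    and ge: "inf (f (x(k := top))) d \<le> f x"
  shows "f x = sup (f (x(k := bot))) (inf (f (x(k := top))) d)"
proof (rule order.antisym)
  have "f x \<le> f (x(k := top))"
    by (rule monoD[OF mono]) (simp add: le_fun_def)
  with le have "f x \<le> inf (f (x(k := top))) (sup (f (x(k := bot))) d)"
    by simp
  also have "\<dots> \<le> sup (f (x(k := bot))) (inf (f (x(k := top))) d)"
    by (simp add: inf_sup_distrib1 le_supI1 le_supI2)
  finally show "f x \<le> sup (f (x(k := bot))) (inf (f (x(k := top))) d)" .
  have "f (x(k := bot)) \<le> f x"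
    by (rule monoD[OF mono]) (simp add: le_fun_def)
  with ge show "sup (f (x(k := bot))) (inf (f (x(k := top))) d) \<le> f x"
    by simp
qed

text \<open>
  The induction runs over the set \<open>A\<close> of coordinates that are still variable, the others being
  held at constants \<open>y\<close>. Decomposing at \<open>k \<in> A\<close> moves \<open>k\<close> to the constant coordinates, with
  value \<open>\<bottom>\<close> or \<open>\<top>\<close>.
\<close>

lemma polynomial_function_if_median_decomposition:
  fixes f :: "('n::finite \<Rightarrow> 'a::bounded_lattice) \<Rightarrow> 'a"
  assumes median: "\<And>x k. f x = sup (f (x(k := bot))) (inf (f (x(k := top))) (d (x k)))"
    and d: "\<And>k::'n. polynomial_function (\<lambda>x::'n \<Rightarrow> 'a. d (x k))"
  shows "polynomial_function f"
proof -
  have "polynomial_function (\<lambda>x. f (\<lambda>i. if i \<in> A then x i else y i))" for A y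
    using finite[of A]
  proof (induction A arbitrary: y rule: finite_induct)
    case empty
    show ?case by (simp add: polynomial_function.const)
  next
    case (insert k A)
    let ?g = "\<lambda>c x. f (\<lambda>i. if i \<in> A then x i else (y(k := c)) i)"
    \<comment> \<open>As \<open>k \<notin> A\<close>, overwriting the \<open>k\<close>th variable amounts to changing the constant at \<open>k\<close>.\<close>
    have upd: "(\<lambda>i. if i \<in> insert k A then x i else y i)(k := c) =
        (\<lambda>i. if i \<in> A then x i else (y(k := c)) i)" for x c
      using insert.hyps by auto
    have "f (\<lambda>i. if i \<in> insert k A then x i else y i) =
        sup (?g bot x) (inf (?g top x) (d (x k)))" for x
      using median[of "\<lambda>i. if i \<in> insert k A then x i else y i" k] unfolding upd by simp
    moreover have "polynomial_function (\<lambda>x. sup (?g bot x) (inf (?g top x) (d (x k))))"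
      by (intro polynomial_function.sup polynomial_function.inf insert.IH d)
    ultimately show ?case by presburger
  qed
  from this[of UNIV] show ?thesis by simp
qed

section \<open>The characterisation\<close>

theorem corollary17:
  fixes f :: "('n::finite \<Rightarrow> 'a::{distrib_lattice, bounded_lattice}) \<Rightarrow> 'a"
  assumes "mono f"
    and "range_idempotent f"
    and "lattice_hom (diag_section f)"
    and "order_convex (range (diag_section f))"
  shows "(polynomial_function f \<longleftrightarrow> quasi_inf_homogeneous f \<and> quasi_sup_homogeneous f)
    \<and> (polynomial_function f \<longleftrightarrow> quasi_inf_homogeneous f \<and> horizontally_sup_decomposable f)
    \<and> (polynomial_function f \<longleftrightarrow> horizontally_inf_decomposable f \<and> quasi_sup_homogeneous f)"
proof -
  let ?d = "diag_section f"
  have "?d c = c" if "c \<in> range ?d" for c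
    using assms(2) that unfolding range_idempotent_def diag_section_def by blast
  then have d_eq: "?d c = inf (sup c (?d bot)) (?d top)" for c
    by (rule retraction_onto_convex_range[OF assms(3,4)])
  have d: "polynomial_function (\<lambda>x::'n \<Rightarrow> 'a. ?d (x k))" for k
    by (subst d_eq) (intro polynomial_function.intros)
  have polynomial: "polynomial_function f"
    if le: "\<And>x k. f x \<le> sup (f (x(k := bot))) (?d (x k))"
      and ge: "\<And>x k. inf (f (x(k := top))) (?d (x k)) \<le> f x"
  proof (rule polynomial_function_if_median_decomposition)
    show "f x = sup (f (x(k := bot))) (inf (f (x(k := top))) (?d (x k)))" for x k
      using assms(1) le[of x k] ge[of x k] by (rule median_decomposition)
  qed (rule d)
  have "polynomial_function f"
    if "quasi_inf_homogeneous f" "quasi_sup_homogeneous f"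
    by (rule polynomial[OF quasi_sup_homogeneous_le[OF that(2)]
          quasi_inf_homogeneous_le[OF that(1)]])
  moreover have "polynomial_function f"
    if "quasi_inf_homogeneous f" "horizontally_sup_decomposable f"
    by (rule polynomial[OF horizontally_sup_decomposable_le[OF assms(1) that(2)]
          quasi_inf_homogeneous_le[OF that(1)]])
  moreover have "polynomial_function f"
    if "horizontally_inf_decomposable f" "quasi_sup_homogeneous f"
    by (rule polynomial[OF quasi_sup_homogeneous_le[OF that(2)]
          horizontally_inf_decomposable_le[OF assms(1) that(1)]])
  ultimately show ?thesis
    using polynomial_quasi_inf_homogeneous polynomial_quasi_sup_homogeneous
      polynomial_horizontally_inf_decomposable polynomial_horizontally_sup_decomposable
    by blast
qed

end
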